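(* Let $1\le K\le N-1$. The $(N,K)$-party generalized fingerprinting inequalities are valid inequalities of the polytope $\mathcal{C}_{N,K}=\mathcal{C}_{N,K}([2]^N;[2])$. That is, every $\mathbf{p}\in\mathcal{C}_{N,K}$ satisfies $$p(0|\overbrace{0\cdots0}^N)+\sum_{i=1}^{K+1}p(1|\overbrace{0\cdots 1_i\cdots0}^{K+1},\overbrace{0\cdots0}^{N-K-1})\le K+1,$$ where $1_i$ means that sender $i$ has input $1$ (all others having input $0$), as well as every inequality obtained from this one by permuting the senders and relabeling the inputs of the senders.
   Context: $[2]=\{0,1\}$. A multiple access channel (MAC) $[2]^N\to[2]$ is a family of conditional probabilities $p(b|a_1\cdots a_N)\ge0$ with $\sum_b p(b|a_1\cdots a_N)=1$; it is viewed as a vector in $\mathbb{R}^{2\cdot 2^N}$. $(N,K)$-local classical MACs: let $0,\mathbf{e}_1,\dots,\mathbf{e}_N$ be distinct symbols and for $S\subseteq\{1,\dots,N\}$ let $\mathcal{M}_S=\{0\}\cup\{\mathbf{e}_s:s\in S\}$. $\mathcal{C}_{N,K}([2]^N;[2])$ is the set of MACs of the form $$p(b|a_1\cdots a_N)=\sum_{S:\,|S|=K}p_S\sum_{m\in\mathcal{M}_S}d(b|m)\,q_S(m|(a_s)_{s\in S}),$$ where $S$ ranges over subsets of $\{1,\dots,N\}$ of size $K$, $(p_S)$ is a probability distribution, each $q_S$ is a stochastic map $[2]^{S}\to\mathcal{M}_S$, and $d$ is a stochastic map $\{0,\mathbf{e}_1,\dots,\mathbf{e}_N\}\to[2]$ (the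 same for all $S$). This set is a convex polytope. A linear inequality is called valid for a polytope if it is satisfied by every point of the polytope. "Relabeling the inputs" means swapping $0\leftrightarrow1$ in the input of some of the senders. *)

theory Defs
  imports "HOL-Analysis.Analysis" "HOL-Library.Z2"
begin

(* Throughout, "q b a" stands for the conditional probability q(b|a). *)

definition stochastic_map :: "'a set \<Rightarrow> 'b set \<Rightarrow> ('b \<Rightarrow> 'a \<Rightarrow> real) \<Rightarrow> bool" where
  "stochastic_map A B q \<longleftrightarrow> (\<forall>a\<in>A. (\<forall>b\<in>B. 0 \<le> q b a) \<and> (\<Sum>b\<in>B. q b a) = 1)"

definition input_strings :: "nat set \<Rightarrow> (nat \<Rightarrow> bit) set" where
  "input_strings S = S \<rightarrow>\<^sub>E {0, 1}"

(* The extensionality condition pins down the values at arguments that are not input strings,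
   so that macs N is a set of vectors indexed by the 2 * 2^N pairs (b, a). *)
definition macs :: "nat \<Rightarrow> (bit \<Rightarrow> (nat \<Rightarrow> bit) \<Rightarrow> real) set" where
  "macs N = {p. stochastic_map (input_strings {1..N}) {0, 1} p \<and>
                (\<forall>b. p b \<in> extensional (input_strings {1..N}))}"

(* Zero is the symbol 0 and E s the symbol e_s of sender s. *)
datatype message = Zero | E nat

definition messages :: "nat set \<Rightarrow> message set" where
  "messages S = insert Zero (E ` S)"

definition sender_subsets :: "nat \<Rightarrow> nat \<Rightarrow> nat set set" where
  "sender_subsets N K = {S. S \<subseteq> {1..N} \<and> card S = K}"

definition local_macs :: "nat \<Rightarrow> nat \<Rightarrow> (bit \<Rightarrow> (nat \<Rightarrow> bit) \<Rightarrow> real) set" where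
  "local_macs N K =
    {p \<in> macs N. \<exists>(w :: nat set \<Rightarrow> real) (q :: nat set \<Rightarrow> message \<Rightarrow> (nat \<Rightarrow> bit) \<Rightarrow> real)
                   (d :: bit \<Rightarrow> message \<Rightarrow> real).
       (\<forall>S\<in>sender_subsets N K. 0 \<le> w S) \<and>
       (\<Sum>S\<in>sender_subsets N K. w S) = 1 \<and>
       (\<forall>S\<in>sender_subsets N K. stochastic_map (input_strings S) (messages S) (q S)) \<and>
       stochastic_map (messages {1..N}) {0, 1} d \<and>
       (\<forall>b. \<forall>a\<in>input_strings {1..N}.
          p b a = (\<Sum>S\<in>sender_subsets N K.
                     w S * (\<Sum>m\<in>messages S. d b m * q S m (restrict a S))))}"

definition zero_input :: "nat \<Rightarrow> nat \<Rightarrow> bit" where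
  "zero_input N = (\<lambda>s\<in>{1..N}. 0)"

definition single_one_input :: "nat \<Rightarrow> nat \<Rightarrow> nat \<Rightarrow> bit" where
  "single_one_input N i = (\<lambda>s\<in>{1..N}. if s = i then 1 else 0)"

definition permute_senders :: "(nat \<Rightarrow> nat) \<Rightarrow> (nat \<Rightarrow> bit) \<Rightarrow> nat \<Rightarrow> bit" where
  "permute_senders \<pi> a = (\<lambda>s. a (\<pi> s))"

(* Addition in bit is modulo 2, so this swaps 0 and 1 for exactly the senders in T. *)
definition relabel_inputs :: "nat set \<Rightarrow> (nat \<Rightarrow> bit) \<Rightarrow> nat \<Rightarrow> bit" where
  "relabel_inputs T a = (\<lambda>s. if s \<in> T then a s + 1 else a s)"

end

theory Submission
  imports Defs
begin

text \<open>
  By linearity it suffices to bound the contribution of a single sender set S with K elements.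
  Some sender i among the K + 1 flipped ones is not in S, so S sees the same inputs when i is
  flipped as when nobody is. The two corresponding terms are then complementary probabilities
  with sum 1, and each of the other K terms is at most 1.
\<close>

lemma stochastic_map_compose:
  assumes q: "stochastic_map A B q" and d: "stochastic_map B C d"
  shows "stochastic_map A C (\<lambda>c a. \<Sum>m\<in>B. d c m * q m a)"
proof -
  have "(\<Sum>c\<in>C. \<Sum>m\<in>B. d c m * q m a) = 1" if "a \<in> A" for a
  proof -
    have "(\<Sum>c\<in>C. \<Sum>m\<in>B. d c m * q m a) = (\<Sum>m\<in>B. (\<Sum>c\<in>C. d c m) * q m a)"
      by (subst sum.swap) (simp add: sum_distrib_right)
    also have "\<dots> = (\<Sum>m\<in>B. q m a)"
      using d by (intro sum.cong) (auto simp: stochastic_map_def)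
    also have "\<dots> = 1"
      using q that by (simp add: stochastic_map_def)
    finally show ?thesis .
  qed
  then show ?thesis
    using q d by (auto simp: stochastic_map_def intro!: sum_nonneg)
qed

lemma stochastic_map_mono:
  "stochastic_map A B q \<Longrightarrow> A' \<subseteq> A \<Longrightarrow> stochastic_map A' B q"
  by (auto simp: stochastic_map_def)

lemma messages_mono: "S \<subseteq> T \<Longrightarrow> messages S \<subseteq> messages T"
  by (auto simp: messages_def)

lemma restrict_input_strings:
  "a \<in> input_strings A \<Longrightarrow> S \<subseteq> A \<Longrightarrow> restrict a S \<in> input_strings S"
  by (auto simp: input_strings_def PiE_iff)

text \<open>The reference input \<open>z\<close> and the inputs \<open>x i\<close> are left
  abstract: all that matters is that \<open>x i\<close> can differ from \<open>z\<close> only at the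
  one sender \<open>f i\<close>, and that these senders are distinct. This shape is preserved by
  permuting senders and relabeling inputs, so one argument covers the whole family of
  inequalities.\<close>

lemma local_macs_fingerprinting:
  assumes p: "p \<in> local_macs N K"
    and z: "z \<in> input_strings {1..N}"
    and x: "\<And>i. i \<in> I \<Longrightarrow> x i \<in> input_strings {1..N}"
    and I: "card I = K + 1" and f: "inj_on f I"
    and eq: "\<And>i s. i \<in> I \<Longrightarrow> s \<noteq> f i \<Longrightarrow> x i s = z s"
  shows "p 0 z + (\<Sum>i\<in>I. p 1 (x i)) \<le> real (K + 1)"
proof -
  obtain w q d where w0: "\<And>S. S \<in> sender_subsets N K \<Longrightarrow> 0 \<le> w S"
    and w1: "(\<Sum>S\<in>sender_subsets N K. w S) = 1"
    and q: "\<And>S. S \<in> sender_subsets N K \<Longrightarrow>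
      stochastic_map (input_strings S) (messages S) (q S)"
    and d: "stochastic_map (messages {1..N}) {0, 1} d"
    and p_eq: "\<And>b a. a \<in> input_strings {1..N} \<Longrightarrow> p b a =
      (\<Sum>S\<in>sender_subsets N K. w S * (\<Sum>m\<in>messages S. d b m * q S m (restrict a S)))"
    using p unfolding local_macs_def by blast
  \<comment> \<open>\<open>r S\<close> is the effective channel from the inputs of the senders in
    \<open>S\<close> to the output bit: encoding by \<open>q S\<close> followed by decoding by the
    common \<open>d\<close>.\<close>
  define r :: "nat set \<Rightarrow> bit \<Rightarrow> (nat \<Rightarrow> bit) \<Rightarrow> real"
    where "r S b a = (\<Sum>m\<in>messages S. d b m * q S m a)" for S b a
  \<comment> \<open>An infinite set would have cardinality 0, but \<open>card I\<close> is
    positive.\<close>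
  have finI: "finite I"
    using I by (simp add: card_ge_0_finite)
  have bound: "r S 0 (restrict z S) + (\<Sum>i\<in>I. r S 1 (restrict (x i) S)) \<le> real (K + 1)"
    if S: "S \<in> sender_subsets N K" for S
  proof -
    have SN: "S \<subseteq> {1..N}" and cardS: "card S = K"
      using S by (auto simp: sender_subsets_def)
    have finS: "finite S"
      using SN finite_subset by blast
    have "stochastic_map (input_strings S) {0, 1} (r S)"
      unfolding r_def
      using stochastic_map_compose[OF q[OF S] stochastic_map_mono[OF d messages_mono[OF SN]]] .
    \<comment> \<open>Together these two facts also give \<open>r S 1 a\<close> \<le> 1, the bound
      used for the senders other than \<open>i\<close>.\<close>
    then have r: "0 \<le> r S 0 a" "r S 0 a + r S 1 a = 1" if "a \<in> input_strings S" for a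
      using that by (auto simp: stochastic_map_def)
    \<comment> \<open>Pigeonhole: by injectivity \<open>f\<close> takes K + 1 values on
      \<open>I\<close>, while \<open>S\<close> has only K elements.\<close>
    have "\<not> f ` I \<subseteq> S"
      using card_mono[OF finS, of "f ` I"] card_image[OF f] I cardS by auto
    then obtain i where i: "i \<in> I" "f i \<notin> S"
      by blast
    have "restrict (x i) S = restrict z S"
      using i eq by (intro restrict_ext) metis
    then have "r S 0 (restrict z S) + r S 1 (restrict (x i) S) = 1"
      using r(2)[OF restrict_input_strings[OF z SN]] by simp
    moreover have "(\<Sum>j\<in>I - {i}. r S 1 (restrict (x j) S)) \<le> (\<Sum>j\<in>I - {i}. 1)"
    proof (rule sum_mono)
      fix j assume "j \<in> I - {i}"
      then have "restrict (x j) S \<in> input_strings S"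
        by (intro restrict_input_strings[OF x SN]) simp
      then show "r S 1 (restrict (x j) S) \<le> 1"
        using r by fastforce
    qed
    \<comment> \<open>Splitting off the index \<open>i\<close> leaves a complementary pair of total
      1 and K terms of at most 1 each.\<close>
    ultimately show ?thesis
      using I i finI by (simp add: sum.remove[of I i])
  qed
  have "p 0 z + (\<Sum>i\<in>I. p 1 (x i)) =
      (\<Sum>S\<in>sender_subsets N K. w S * r S 0 (restrict z S)) +
      (\<Sum>i\<in>I. \<Sum>S\<in>sender_subsets N K. w S * r S 1 (restrict (x i) S))"
    using p_eq z x by (simp add: r_def)
  \<comment> \<open>Exchanging the sums exhibits the left-hand side as a convex combination, with
    weights \<open>w S\<close>, of the quantities bounded above.\<close>
  also have "\<dots> = (\<Sum>S\<in>sender_subsets N K.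
      w S * (r S 0 (restrict z S) + (\<Sum>i\<in>I. r S 1 (restrict (x i) S))))"
    by (subst sum.swap) (simp add: sum.distrib sum_distrib_left distrib_left)
  also have "\<dots> \<le> (\<Sum>S\<in>sender_subsets N K. w S * real (K + 1))"
    by (intro sum_mono mult_left_mono bound w0)
  also have "\<dots> = real (K + 1)"
    using w1 by (simp flip: sum_distrib_right)
  finally show ?thesis .
qed

text \<open>The point at issue is extensionality: outside \<open>A\<close> the permutation fixes
  every sender and no bit is flipped, so the value \<open>undefined\<close> survives there.\<close>

lemma relabel_permute_input_strings:
  assumes "\<pi> permutes A" "T \<subseteq> A" "a \<in> input_strings A"
  shows "relabel_inputs T (permute_senders \<pi> a) \<in> input_strings A"
proof -
  have bit: "b \<in> {0, 1}" for b :: bit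
    by (cases b) auto
  have "relabel_inputs T (permute_senders \<pi> a) s = undefined" if "s \<notin> A" for s
    using that assms permutes_not_in[OF assms(1) that]
    by (auto simp: relabel_inputs_def permute_senders_def input_strings_def PiE_iff extensional_def)
  then show ?thesis
    using bit unfolding input_strings_def by (auto intro!: PiE_I)
qed

theorem proposition3:
  fixes N K :: nat
  assumes "1 \<le> K" and "K \<le> N - 1"
  shows "(\<forall>p\<in>local_macs N K.
            p 0 (zero_input N) + (\<Sum>i=1..K+1. p 1 (single_one_input N i)) \<le> real (K + 1)) \<and>
         (\<forall>\<pi> T. \<pi> permutes {1..N} \<longrightarrow> T \<subseteq> {1..N} \<longrightarrow>
            (\<forall>p\<in>local_macs N K.
               p 0 (relabel_inputs T (permute_senders \<pi> (zero_input N))) +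
               (\<Sum>i=1..K+1. p 1 (relabel_inputs T (permute_senders \<pi> (single_one_input N i))))
               \<le> real (K + 1)))"
proof -
  have general: "p 0 (relabel_inputs T (permute_senders \<pi> (zero_input N))) +
      (\<Sum>i=1..K+1. p 1 (relabel_inputs T (permute_senders \<pi> (single_one_input N i))))
      \<le> real (K + 1)"
    if \<pi>: "\<pi> permutes {1..N}" and T: "T \<subseteq> {1..N}" and p: "p \<in> local_macs N K" for \<pi> T p
  \<comment> \<open>After permuting, sender \<open>s\<close> receives the bit originally at position
    \<open>\<pi> s\<close>, so the single 1 at position \<open>i\<close> ends up at sender
    \<open>inv \<pi> i\<close>. Relabeling flips the same senders in both inputs and hence creates
    no new differences.\<close>
  proof (rule local_macs_fingerprinting[OF p, where f = "inv \<pi>"])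
    show "relabel_inputs T (permute_senders \<pi> (zero_input N)) \<in> input_strings {1..N}"
      using \<pi> T by (rule relabel_permute_input_strings) (auto simp: input_strings_def zero_input_def)
    show "relabel_inputs T (permute_senders \<pi> (single_one_input N i)) \<in> input_strings {1..N}" for i
      using \<pi> T
      by (rule relabel_permute_input_strings) (auto simp: input_strings_def single_one_input_def)
    show "inj_on (inv \<pi>) {1..K+1}"
      using permutes_inj[OF permutes_inv[OF \<pi>]] by (rule inj_on_subset) simp
    show "relabel_inputs T (permute_senders \<pi> (single_one_input N i)) s =
        relabel_inputs T (permute_senders \<pi> (zero_input N)) s" if "s \<noteq> inv \<pi> i" for i s
    proof -
      have "\<pi> s \<noteq> i"
        using that permutes_inverses(2)[OF \<pi>] by auto
      then show ?thesis
        by (simp add: relabel_inputs_def permute_senders_def single_one_input_def zero_input_def)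
    qed
  qed simp
  \<comment> \<open>The original inequality is the instance with the identity permutation and no
    sender relabeled.\<close>
  have "relabel_inputs {} (permute_senders id a) = a" for a
    by (simp add: relabel_inputs_def permute_senders_def)
  then show ?thesis
    using general general[OF permutes_id, of "{}"] by simp
qed

end
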